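(* Let $0<\rho<1/2$ and let the initial configuration $\eta_0$ of the F-TASEP be distributed according to the Bernoulli product measure $\mu^{(\rho)}$ of density $\rho$ on $\{0,1\}^{\mathbb Z}$. Conditionally on $\eta_0(0)=1$, let $D$ be the total distance moved, over the whole evolution $t=0,1,2,\dots$, by the particle initially at the origin. Then $D$ has a geometric distribution with ratio $\rho/(1-\rho)$, i.e. $$\mu^{(\rho)}(D=d\mid\eta_0(0)=1)=\frac{1-2\rho}{1-\rho}\left(\frac{\rho}{1-\rho}\right)^d,\qquad d=0,1,2,\dots,$$ and its mean is $\rho/(1-2\rho)$.
   Context: F-TASEP on $\{0,1\}^{\mathbb Z}$ ($1$ = particle, $0$ = hole): at each integer time step, simultaneously, every particle at a site $j$ with $\eta(j-1)=1$ and $\eta(j+1)=0$ (occupations before the step) moves to $j+1$. A given particle is followed through its successive positions; the distance it moves is the total number of jumps it makes (for $\rho<1/2$ the configuration almost surely freezes locally, so this is a.s. finite). *)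

theory Defs
  imports "HOL-Probability.Probability"
begin

type_synonym config = "int \<Rightarrow> bool"

definition ftasep_jumps :: "config \<Rightarrow> int \<Rightarrow> bool" where
  "ftasep_jumps \<eta> j \<longleftrightarrow> \<eta> j \<and> \<eta> (j - 1) \<and> \<not> \<eta> (j + 1)"

definition ftasep_step :: "config \<Rightarrow> config" where
  "ftasep_step \<eta> = (\<lambda>j. (\<eta> j \<and> \<not> ftasep_jumps \<eta> j) \<or> ftasep_jumps \<eta> (j - 1))"

definition ftasep :: "config \<Rightarrow> nat \<Rightarrow> config" where
  "ftasep \<eta>\<^sub>0 t = (ftasep_step ^^ t) \<eta>\<^sub>0"

text \<open>Position at time \<open>t\<close> of the particle initially at \<open>x\<close>; meaningful only if \<open>\<eta>\<^sub>0 x\<close> holds.\<close>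

primrec particle_pos :: "config \<Rightarrow> int \<Rightarrow> nat \<Rightarrow> int" where
  "particle_pos \<eta>\<^sub>0 x 0 = x"
| "particle_pos \<eta>\<^sub>0 x (Suc t) =
     (if ftasep_jumps (ftasep \<eta>\<^sub>0 t) (particle_pos \<eta>\<^sub>0 x t)
      then particle_pos \<eta>\<^sub>0 x t + 1 else particle_pos \<eta>\<^sub>0 x t)"

definition jump_times :: "config \<Rightarrow> int \<Rightarrow> nat set" where
  "jump_times \<eta>\<^sub>0 x = {t. ftasep_jumps (ftasep \<eta>\<^sub>0 t) (particle_pos \<eta>\<^sub>0 x t)}"

text \<open>The value is \<open>\<infinity>\<close> if the particle jumps infinitely often, since \<open>card\<close> is \<open>0\<close> on infinite sets.\<close>

definition total_distance :: "config \<Rightarrow> int \<Rightarrow> enat" where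
  "total_distance \<eta>\<^sub>0 x =
     (if finite (jump_times \<eta>\<^sub>0 x) then enat (card (jump_times \<eta>\<^sub>0 x)) else \<infinity>)"

definition bernoulli_product :: "real \<Rightarrow> config measure" where
  "bernoulli_product \<rho> = (\<Pi>\<^sub>M j\<in>UNIV. measure_pmf (bernoulli_pmf \<rho>))"

end

theory Submission
  imports Defs
begin

text \<open>Seen from the tagged particle at \<open>x\<close>, let \<open>M\<close> be the maximum over \<open>y \<le> x\<close> of the number of
  particles minus the number of holes in \<open>[y, x - 1]\<close>. A step of the dynamics lowers \<open>M\<close> by one if
  the tagged particle jumps and leaves it unchanged otherwise, and the particle cannot stop while
  \<open>M > 0\<close> as long as there are infinitely many holes to its right. Hence \<open>D\<close> is the initial value
  of \<open>M\<close>, the maximum of a simple random walk with up-probability \<open>\<rho> < 1 / 2\<close> that is independent of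
  the occupation of the origin; by first-step analysis \<open>M \<ge> d\<close> has probability
  \<open>(\<rho> / (1 - \<rho>)) ^ d\<close>.\<close>

section \<open>The distance as the maximum of a random walk\<close>

text \<open>For fixed \<open>x\<close> and \<open>y\<close> decreasing from \<open>x\<close>, this
  is a nearest-neighbour walk started at 0. Site \<open>x\<close> itself is left out, which makes
  the walk independent of its occupation.\<close>

definition excess :: "config \<Rightarrow> int \<Rightarrow> int \<Rightarrow> int" where
  "excess \<eta> y x = (\<Sum>j\<in>{y..<x}. if \<eta> j then 1 else -1)"

lemma excess_empty: "x \<le> y \<Longrightarrow> excess \<eta> y x = 0"
  by (simp add: excess_def)

lemma excess_left: "y < x \<Longrightarrow> excess \<eta> y x = (if \<eta> y then 1 else -1) + excess \<eta> (y + 1) x"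
proof -
  assume "y < x"
  then have "{y..<x} = insert y {y + 1..<x}" by auto
  then show ?thesis by (simp add: excess_def)
qed

lemma excess_right:
  assumes "y < x"
  shows "excess \<eta> y x = excess \<eta> y (x - 1) + (if \<eta> (x - 1) then 1 else -1)"
proof -
  have "{y..<x} = insert (x - 1) {y..<x - 1}" using assms by auto
  then show ?thesis by (simp add: excess_def)
qed

lemma excess_cong: "(\<And>j. y \<le> j \<Longrightarrow> j < x \<Longrightarrow> \<eta> j = \<zeta> j) \<Longrightarrow> excess \<eta> y x = excess \<zeta> y x"
  unfolding excess_def by (rule sum.cong) auto

text \<open>Conservation of particles: one entering at \<open>y\<close> replaces a hole, hence the
  2. At the right end nothing leaves \<open>x - 1\<close>, since \<open>x\<close> is occupied; if
  the tagged particle jumps, its vacated site joins the interval as a hole.\<close>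

lemma excess_step:
  assumes "\<eta> x" and "y \<le> x"
  shows "excess (ftasep_step \<eta>) y (x + of_bool (ftasep_jumps \<eta> x))
    = excess \<eta> y x - of_bool (ftasep_jumps \<eta> x) + 2 * of_bool (ftasep_jumps \<eta> (y - 1))"
  using assms(2)
proof (induction y rule: int_le_induct)
  case base
  have "\<not> ftasep_jumps \<eta> (x - 1)"
    using assms(1) by (simp add: ftasep_jumps_def)
  then show ?case
    by (auto simp: excess_empty excess_left ftasep_step_def)
next
  case (step i)
  \<comment> \<open>Continuity equation at site \<open>i - 1\<close>: its outflow cancels the inflow
    term of the induction hypothesis.\<close>
  have *: "(if ftasep_step \<eta> (i - 1) then 1 else -1 :: int) = (if \<eta> (i - 1) then 1 else -1)
      - 2 * of_bool (ftasep_jumps \<eta> (i - 1)) + 2 * of_bool (ftasep_jumps \<eta> (i - 1 - 1))"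
    by (auto simp: ftasep_step_def ftasep_jumps_def)
  have "excess (ftasep_step \<eta>) (i - 1) (x + of_bool (ftasep_jumps \<eta> x)) =
      (if ftasep_step \<eta> (i - 1) then 1 else -1) + excess (ftasep_step \<eta>) i (x + of_bool (ftasep_jumps \<eta> x))"
    using step.hyps by (subst excess_left) auto
  moreover have "excess \<eta> (i - 1) x = (if \<eta> (i - 1) then 1 else -1) + excess \<eta> i x"
    using step.hyps by (subst excess_left) auto
  ultimately show ?case
    using step.IH * by linarith
qed

text \<open>A relation rather than a function, because a maximum over infinitely many
  \<open>y\<close> need not exist.\<close>

definition is_max_excess :: "config \<Rightarrow> int \<Rightarrow> int \<Rightarrow> bool" where
  "is_max_excess \<eta> x m \<longleftrightarrow> (\<exists>y\<le>x. excess \<eta> y x = m) \<and> (\<forall>y\<le>x. excess \<eta> y x \<le> m)"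

lemma is_max_excess_nonneg: "is_max_excess \<eta> x m \<Longrightarrow> 0 \<le> m"
  unfolding is_max_excess_def using excess_empty[of x x \<eta>] by auto

lemma is_max_excess_step:
  assumes "\<eta> x" and m: "is_max_excess \<eta> x m"
  shows "is_max_excess (ftasep_step \<eta>) (x + of_bool (ftasep_jumps \<eta> x)) (m - of_bool (ftasep_jumps \<eta> x))"
proof -
  let ?x = "x + of_bool (ftasep_jumps \<eta> x)" and ?m = "m - of_bool (ftasep_jumps \<eta> x)"
  have upper: "excess (ftasep_step \<eta>) y ?x \<le> ?m" if "y \<le> ?x" for y
  proof (cases "y \<le> x")
    case True
    \<comment> \<open>A jump into \<open>y\<close> needs particles at \<open>y - 2\<close> and \<open>y - 1\<close>, so the walk started at \<open>y - 2\<close>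
      already had the larger value.\<close>
    have "excess \<eta> y x + 2 * of_bool (ftasep_jumps \<eta> (y - 1)) \<le> m"
    proof (cases "ftasep_jumps \<eta> (y - 1)")
      case j: True
      have "excess \<eta> (y - 2) x = 2 + excess \<eta> y x"
        using True j by (simp add: excess_left ftasep_jumps_def)
      moreover have "excess \<eta> (y - 2) x \<le> m"
        using m True by (simp add: is_max_excess_def)
      ultimately show ?thesis using j by simp
    qed (use m True in \<open>simp add: is_max_excess_def\<close>)
    then show ?thesis
      using excess_step[of \<eta> x y] assms(1) True by simp
  next
    case False
    then have j: "ftasep_jumps \<eta> x" and "y = x + 1"
      using that by (auto simp: of_bool_def split: if_splits)
    \<comment> \<open>The one new starting point is the new position, with value 0. A jump needs a
      particle at \<open>x - 1\<close>, so \<open>m\<close> was at least 1 before.\<close>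
    have "excess \<eta> (x - 1) x \<le> m"
      using m by (simp add: is_max_excess_def)
    then have "1 \<le> m"
      using j by (simp add: excess_left excess_empty ftasep_jumps_def)
    then show ?thesis
      using j \<open>y = x + 1\<close> by (simp add: excess_empty)
  qed
  \<comment> \<open>An old maximiser stays one: its value falls by at most the jump term, and
    \<open>upper\<close> bounds it from above.\<close>
  obtain y where y: "y \<le> x" "excess \<eta> y x = m"
    using m by (auto simp: is_max_excess_def)
  have "y \<le> ?x" using y by (simp add: of_bool_def)
  moreover have "excess (ftasep_step \<eta>) y ?x \<ge> ?m"
    using excess_step[of \<eta> x y] assms(1) y by simp
  ultimately have "excess (ftasep_step \<eta>) y ?x = ?m"
    using upper[of y] by simp
  with \<open>y \<le> ?x\<close> upper show ?thesis
    by (auto simp: is_max_excess_def)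
qed

section \<open>Evolution along the trajectory of the tagged particle\<close>

lemma ftasep_Suc: "ftasep \<eta> (Suc t) = ftasep_step (ftasep \<eta> t)"
  by (simp add: ftasep_def)

lemma particle_pos_Suc:
  "particle_pos \<eta> x (Suc t) = particle_pos \<eta> x t + of_bool (ftasep_jumps (ftasep \<eta> t) (particle_pos \<eta> x t))"
  by simp

lemma ftasep_particle_pos: "\<eta> x \<Longrightarrow> ftasep \<eta> t (particle_pos \<eta> x t)"
proof (induction t)
  case 0
  then show ?case by (simp add: ftasep_def)
next
  case (Suc t)
  then show ?case by (auto simp: ftasep_Suc ftasep_step_def ftasep_jumps_def)
qed

text \<open>Conservation law: each jump uses up exactly one unit of the maximum.\<close>

lemma is_max_excess_ftasep:
  assumes "\<eta> x" and "is_max_excess \<eta> x m"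
  shows "is_max_excess (ftasep \<eta> t) (particle_pos \<eta> x t) (m - int (card (jump_times \<eta> x \<inter> {..<t})))"
proof (induction t)
  case 0
  then show ?case using assms by (simp add: ftasep_def)
next
  case (Suc t)
  have "jump_times \<eta> x \<inter> {..<Suc t} =
      (if t \<in> jump_times \<eta> x then insert t (jump_times \<eta> x \<inter> {..<t}) else jump_times \<eta> x \<inter> {..<t})"
    by (auto simp: less_Suc_eq)
  then have "int (card (jump_times \<eta> x \<inter> {..<Suc t})) = int (card (jump_times \<eta> x \<inter> {..<t}))
      + of_bool (ftasep_jumps (ftasep \<eta> t) (particle_pos \<eta> x t))"
    by (simp add: jump_times_def)
  then show ?case
    using is_max_excess_step[of _ _ "m - int (card (jump_times \<eta> x \<inter> {..<t}))", OF ftasep_particle_pos[of \<eta> x t] Suc]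
      assms(1)
    unfolding ftasep_Suc particle_pos_Suc by (simp only: diff_diff_eq)
qed

section \<open>Persistence of holes and the final value of the maximum\<close>

lemma infinite_holes_ftasep:
  assumes "\<And>n. \<exists>j\<ge>n. \<not> \<eta> j"
  shows "\<exists>j\<ge>n. \<not> ftasep \<eta> t j"
proof (induction t arbitrary: n)
  case 0
  then show ?case using assms by (simp add: ftasep_def)
next
  case (Suc t)
  \<comment> \<open>The slack in \<open>n + 1\<close> lets the hole move one site left: whatever
    fills \<open>j\<close> comes from \<open>j - 1\<close>, which cannot be refilled in the same
    step.\<close>
  obtain j where j: "j \<ge> n + 1" "\<not> ftasep \<eta> t j" using Suc by blast
  show ?case
  proof (cases "ftasep \<eta> (Suc t) j")
    case True
    then have "\<not> ftasep \<eta> (Suc t) (j - 1)"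
      using j by (auto simp: ftasep_Suc ftasep_step_def ftasep_jumps_def)
    with j show ?thesis by (intro exI[of _ "j - 1"]) auto
  next
    case False
    with j show ?thesis by (intro exI[of _ j]) auto
  qed
qed

text \<open>Two neighbouring sites that are never vacated force every site to their right to be occupied,
  since a hole behind a pair of particles is filled from that pair.\<close>

lemma occupied_forever_right:
  assumes "\<And>t. t \<ge> T \<Longrightarrow> ftasep \<eta> t y \<and> ftasep \<eta> t (y + 1)"
  shows "t \<ge> T \<Longrightarrow> ftasep \<eta> t (y + int k) \<and> ftasep \<eta> t (y + int k + 1)"
proof (induction k arbitrary: t)
  case 0
  then show ?case using assms by simp
next
  case (Suc k)
  have "ftasep \<eta> t (y + int k + 2)"
  proof (rule ccontr)
    assume "\<not> ftasep \<eta> t (y + int k + 2)"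
    then have "ftasep_jumps (ftasep \<eta> t) (y + int k + 1)"
      using Suc.IH[OF Suc.prems] by (simp add: ftasep_jumps_def add.commute)
    then have "\<not> ftasep \<eta> (Suc t) (y + int k + 1)"
      by (auto simp: ftasep_Suc ftasep_step_def ftasep_jumps_def)
    then show False using Suc.IH[of "Suc t"] Suc.prems by simp
  qed
  then show ?case using Suc.IH[OF Suc.prems] by (simp add: algebra_simps)
qed

text \<open>If the particle stopped with a positive maximum, consider the rightmost maximiser ever
  occurring: this site and the next one stay occupied forever.\<close>

lemma stuck_imp_max_eq_0:
  assumes "\<eta> x" and holes: "\<And>n. \<exists>j\<ge>n. \<not> \<eta> j"
    and max: "\<And>t. t \<ge> T \<Longrightarrow> is_max_excess (ftasep \<eta> t) X m"
    and pos: "\<And>t. t \<ge> T \<Longrightarrow> particle_pos \<eta> x t = X"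
  shows "m = 0"
proof (rule ccontr)
  assume "m \<noteq> 0"
  then have "m > 0"
    using is_max_excess_nonneg[OF max[of T]] by simp
  have occ: "ftasep \<eta> t X" if "t \<ge> T" for t
    using ftasep_particle_pos[of \<eta> x t, OF assms(1)] pos[OF that] by simp
  have nojump: "\<not> ftasep_jumps (ftasep \<eta> t) X" if "t \<ge> T" for t
    using pos[OF that] pos[of "Suc t"] that by (auto split: if_splits)
  \<comment> \<open>With the tagged particle at rest, particles may enter the interval but none
    leave it.\<close>
  have mono: "excess (ftasep \<eta> t) y X \<le> excess (ftasep \<eta> (Suc t)) y X" if "t \<ge> T" "y \<le> X" for t y
    using excess_step[of "ftasep \<eta> t" X y, OF occ[OF that(1)] that(2)] nojump[OF that(1)] by (simp add: ftasep_Suc)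
  \<comment> \<open>Sites that are maximisers at some time from \<open>T\<close> on. They are
    bounded by \<open>X\<close>, so there is a rightmost one.\<close>
  define A where "A y \<longleftrightarrow> y \<le> X \<and> (\<exists>t\<ge>T. excess (ftasep \<eta> t) y X = m)" for y
  obtain y0 where y0: "A y0"
    using max[of T] by (auto simp: A_def is_max_excess_def)
  have fin: "finite {y. A y \<and> y0 \<le> y}"
    by (rule finite_subset[of _ "{y0..X}"]) (auto simp: A_def)
  define y where "y = Max {y. A y \<and> y0 \<le> y}"
  have y: "A y" "y0 \<le> y"
    using Max_in[OF fin] y0 by (auto simp: y_def)
  have above: "\<not> A z" if "y < z" for z
    using Max_ge[OF fin, of z] that y(2) by (auto simp: y_def)
  obtain S where S: "S \<ge> T" "excess (ftasep \<eta> S) y X = m"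
    using y by (auto simp: A_def)
  have "y \<noteq> X" using S \<open>m > 0\<close> by (auto simp: excess_empty)
  then have "y < X" using y by (auto simp: A_def)
  \<comment> \<open>Monotonicity in time together with the bound \<open>m\<close> makes being a
    maximiser permanent.\<close>
  have ym: "excess (ftasep \<eta> t) y X = m" if "t \<ge> S" for t
    using that
  proof (induction t rule: dec_induct)
    case (step t)
    have "excess (ftasep \<eta> (Suc t)) y X \<le> m"
      using max[of "Suc t"] S(1) step.hyps \<open>y < X\<close> by (auto simp: is_max_excess_def)
    with step mono[of t y] S(1) \<open>y < X\<close> show ?case by simp
  qed (use S in simp)
  have below: "excess (ftasep \<eta> t) z X < m" if "t \<ge> S" "y < z" "z \<le> X" for t z
  proof -
    have "t \<ge> T" using that S by simp
    then have "excess (ftasep \<eta> t) z X \<le> m"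
      using max that by (auto simp: is_max_excess_def)
    moreover have "excess (ftasep \<eta> t) z X \<noteq> m"
      using above[OF that(2)] that(3) \<open>t \<ge> T\<close> by (auto simp: A_def)
    ultimately show ?thesis by simp
  qed
  \<comment> \<open>The walk equals \<open>m\<close> at \<open>y\<close> but is smaller at
    \<open>y + 1\<close> and \<open>y + 2\<close>, so neither site can be a hole. If
    \<open>y + 1 = X\<close>, the tagged particle itself occupies it.\<close>
  have "ftasep \<eta> t y \<and> ftasep \<eta> t (y + 1)" if "t \<ge> S" for t
  proof -
    have 1: "excess (ftasep \<eta> t) y X = (if ftasep \<eta> t y then 1 else -1) + excess (ftasep \<eta> t) (y + 1) X"
      using \<open>y < X\<close> by (rule excess_left)
    have 2: "excess (ftasep \<eta> t) (y + 1) X < m"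
      using below[OF that, of "y + 1"] \<open>y < X\<close> by simp
    have 3: "ftasep \<eta> t y"
      using 1 2 ym[OF that] by (auto split: if_splits)
    have "ftasep \<eta> t (y + 1)"
    proof (cases "y + 1 = X")
      case True
      then show ?thesis using occ[of t] that S by simp
    next
      case False
      then have "y + 1 < X" using \<open>y < X\<close> by simp
      then have "excess (ftasep \<eta> t) (y + 1) X
          = (if ftasep \<eta> t (y + 1) then 1 else -1) + excess (ftasep \<eta> t) (y + 2) X"
        using excess_left[of "y + 1" X] by (simp add: add.commute)
      moreover have "excess (ftasep \<eta> t) (y + 2) X < m"
        using below[OF that, of "y + 2"] \<open>y + 1 < X\<close> by simp
      ultimately show ?thesis
        using 1 3 ym[OF that] by (auto split: if_splits)
    qed
    with 3 show ?thesis by simp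
  qed
  note right = occupied_forever_right[of S \<eta> y, OF this, of S]
  obtain j where "j \<ge> y" "\<not> ftasep \<eta> S j"
    using infinite_holes_ftasep[OF holes] by blast
  then show False
    using right[of "nat (j - y)"] by simp
qed

text \<open>The maximum stays nonnegative and each jump lowers it by one, so at most
  \<open>m\<close> jumps occur; after the last one it must be 0, so there are exactly
  \<open>m\<close>.\<close>

theorem total_distance_eq_max_excess:
  assumes "\<eta> x" and holes: "\<And>n. \<exists>j\<ge>n. \<not> \<eta> j" and max: "is_max_excess \<eta> x (int m)"
  shows "total_distance \<eta> x = enat m"
proof -
  let ?J = "jump_times \<eta> x"
  have *: "is_max_excess (ftasep \<eta> t) (particle_pos \<eta> x t) (int m - int (card (?J \<inter> {..<t})))" for t
    using assms by (intro is_max_excess_ftasep)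
  have bound: "card (?J \<inter> {..<t}) \<le> m" for t
    using is_max_excess_nonneg[OF *[of t]] by simp
  have fin: "finite ?J"
  proof (rule ccontr)
    assume "infinite ?J"
    then obtain B where B: "B \<subseteq> ?J" "finite B" "card B = Suc m"
      using infinite_arbitrarily_large by blast
    then have "B \<subseteq> ?J \<inter> {..<Suc (Max B)}"
      by (auto simp: less_Suc_eq_le)
    then have "Suc m \<le> card (?J \<inter> {..<Suc (Max B)})"
      using B card_mono by (metis finite_Int finite_lessThan)
    with bound[of "Suc (Max B)"] show False by simp
  qed
  then obtain T where T: "?J \<subseteq> {..<T}"
    using finite_nat_iff_bounded by blast
  have nojump: "\<not> ftasep_jumps (ftasep \<eta> t) (particle_pos \<eta> x t)" if "t \<ge> T" for t
    using T that by (auto simp: jump_times_def)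
  have pos: "particle_pos \<eta> x t = particle_pos \<eta> x T" if "t \<ge> T" for t
    using that
  proof (induction t rule: dec_induct)
    case (step t)
    then show ?case using nojump[of t] by simp
  qed simp
  have J: "?J \<inter> {..<t} = ?J" if "t \<ge> T" for t
    using T that by auto
  have "int m - int (card ?J) = 0"
  proof (rule stuck_imp_max_eq_0[OF assms(1) holes _ pos])
    show "is_max_excess (ftasep \<eta> t) (particle_pos \<eta> x T) (int m - int (card ?J))" if "t \<ge> T" for t
      using *[of t] pos[OF that] J[OF that] by simp
  qed
  with fin show ?thesis by (simp add: total_distance_def)
qed

section \<open>The law of the maximum\<close>

lemma space_bernoulli_product [simp]: "space (bernoulli_product \<rho>) = UNIV"
  by (simp add: bernoulli_product_def space_PiM PiE_UNIV_domain)

lemma prob_space_bernoulli_product: "prob_space (bernoulli_product \<rho>)"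
  unfolding bernoulli_product_def by (intro prob_space_PiM measure_pmf.prob_space_axioms)

lemma measurable_site [measurable]: "Measurable.pred (bernoulli_product \<rho>) (\<lambda>\<eta>. \<eta> j)"
proof -
  have "(\<lambda>\<eta>. \<eta> j) \<in> measurable (bernoulli_product \<rho>) (measure_pmf (bernoulli_pmf \<rho>))"
    unfolding bernoulli_product_def by (rule measurable_component_singleton) simp
  then show ?thesis by simp
qed

lemma measurable_excess [measurable]:
  "(\<lambda>\<eta>. excess \<eta> y x) \<in> measurable (bernoulli_product \<rho>) (count_space UNIV)"
proof -
  have "(\<lambda>\<eta>. \<Sum>j\<in>F. if \<eta> j then 1 else -1 :: int)
      \<in> measurable (bernoulli_product \<rho>) (count_space UNIV)" if "finite F" for F
    using that
  proof (induction F rule: finite_induct)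
    case (insert j F)
    then have [measurable]: "(\<lambda>\<eta>. \<Sum>j\<in>F. if \<eta> j then 1 else -1 :: int)
        \<in> measurable (bernoulli_product \<rho>) (count_space UNIV)" by simp
    have "(\<lambda>\<eta>. (if \<eta> j then 1 else -1) + (\<Sum>j\<in>F. if \<eta> j then 1 else -1 :: int))
        \<in> measurable (bernoulli_product \<rho>) (count_space UNIV)"
      by measurable
    with insert.hyps show ?case by simp
  qed simp
  then show ?thesis unfolding excess_def by simp
qed

text \<open>Overwriting coordinate \<open>i\<close> by an independent Bernoulli variable preserves
  the product measure; Fubini then conditions on the new value. All independence used below enters
  through this identity.\<close>

lemma resample_site:
  assumes "0 \<le> \<rho>" "\<rho> \<le> 1" and E: "Measurable.pred (bernoulli_product \<rho>) E"
  shows "measure (bernoulli_product \<rho>) {\<eta>. E \<eta>}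
    = \<rho> * measure (bernoulli_product \<rho>) {\<eta>. E (\<eta>(i := True))}
      + (1 - \<rho>) * measure (bernoulli_product \<rho>) {\<eta>. E (\<eta>(i := False))}"
proof -
  let ?M = "bernoulli_product \<rho>" and ?B = "measure_pmf (bernoulli_pmf \<rho>)"
  interpret prob_space ?M by (rule prob_space_bernoulli_product)
  have upd: "(\<lambda>(x, X). X(i := x)) \<in> measurable (?B \<Otimes>\<^sub>M ?M) ?M"
    using measurable_compose[OF measurable_pair_swap' measurable_add_dim[of i UNIV "\<lambda>_. ?B"]]
    by (simp add: bernoulli_product_def split_beta' comp_def)
  have M: "distr (?B \<Otimes>\<^sub>M ?M) ?M (\<lambda>(x, X). X(i := x)) = ?M"
    using distr_pair_PiM_eq_PiM[of UNIV "\<lambda>_. ?B" i]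
    by (simp add: bernoulli_product_def measure_pmf.prob_space_axioms)
  have sE: "{\<eta>. E \<eta>} \<in> sets ?M"
    using E by (simp add: pred_def)
  let ?A = "(\<lambda>(x, X). X(i := x)) -` {\<eta>. E \<eta>} \<inter> space (?B \<Otimes>\<^sub>M ?M)"
  have "emeasure ?M {\<eta>. E \<eta>} = emeasure (distr (?B \<Otimes>\<^sub>M ?M) ?M (\<lambda>(x, X). X(i := x))) {\<eta>. E \<eta>}"
    by (simp only: M)
  also have "\<dots> = emeasure (?B \<Otimes>\<^sub>M ?M) ?A"
    by (rule emeasure_distr[OF upd sE])
  also have "\<dots> = (\<integral>\<^sup>+ x. emeasure ?M (Pair x -` ?A) \<partial>?B)"
    by (rule emeasure_pair_measure_alt[OF measurable_sets[OF upd sE]])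
  also have "\<dots> = (\<integral>\<^sup>+ x. emeasure ?M {\<eta>. E (\<eta>(i := x))} \<partial>?B)"
    by (intro nn_integral_cong arg_cong[where f = "emeasure ?M"]) (auto simp: space_pair_measure)
  also have "\<dots> = ennreal (\<rho> * prob {\<eta>. E (\<eta>(i := True))} + (1 - \<rho>) * prob {\<eta>. E (\<eta>(i := False))})"
    using assms by (simp add: emeasure_eq_measure ennreal_mult ennreal_plus mult.commute)
  finally have "ennreal (prob {\<eta>. E \<eta>})
      = ennreal (\<rho> * prob {\<eta>. E (\<eta>(i := True))} + (1 - \<rho>) * prob {\<eta>. E (\<eta>(i := False))})"
    by (simp only: emeasure_eq_measure)
  then show ?thesis
    using assms by (subst (asm) ennreal_inj) auto
qed

section \<open>Hitting probabilities of the simple random walk\<close>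

fun hit_prob :: "real \<Rightarrow> nat \<Rightarrow> nat \<Rightarrow> real" where
  "hit_prob \<rho> n 0 = 1"
| "hit_prob \<rho> 0 (Suc d) = 0"
| "hit_prob \<rho> (Suc n) (Suc d) = \<rho> * hit_prob \<rho> n d + (1 - \<rho>) * hit_prob \<rho> n (Suc (Suc d))"

text \<open>\<open>hit_prob \<rho> n d\<close> is the chance that the walk reaches level
  \<open>d\<close> within \<open>n\<close> steps. The first step is site \<open>a - 1\<close>;
  keeping \<open>a\<close> arbitrary lets the base point move there.\<close>

lemma prob_excess_hit:
  assumes "0 \<le> \<rho>" "\<rho> \<le> 1"
  shows "measure (bernoulli_product \<rho>) {\<eta>. \<exists>y\<in>{a - int n..a}. int d \<le> excess \<eta> y a} = hit_prob \<rho> n d"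
  using assms
proof (induction \<rho> n d arbitrary: a rule: hit_prob.induct)
  case (1 \<rho> n)
  interpret prob_space "bernoulli_product \<rho>" by (rule prob_space_bernoulli_product)
  have "{\<eta>. \<exists>y\<in>{a - int n..a}. int 0 \<le> excess \<eta> y a} = space (bernoulli_product \<rho>)"
    by (auto intro!: bexI[of _ a] simp: excess_empty)
  then show ?case using prob_space by simp
next
  case (2 \<rho> d)
  then show ?case by (simp add: excess_empty)
next
  case (3 \<rho> n d)
  \<comment> \<open>The start \<open>y = a\<close> has value 0, below \<open>Suc d\<close>, and
    drops out. For the other starts, fixing site \<open>a - 1\<close> shifts the required level by
    one.\<close>
  have *: "(\<exists>y\<in>{a - int (Suc n)..a}. int (Suc d) \<le> excess (\<eta>(a - 1 := b)) y a)
      \<longleftrightarrow> (\<exists>y\<in>{a - 1 - int n..a - 1}. int (Suc d) - (if b then 1 else -1) \<le> excess \<eta> y (a - 1))"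
    (is "?L \<longleftrightarrow> ?R") for \<eta> :: config and b
  proof -
    have "?L \<longleftrightarrow> (\<exists>y\<in>{a - 1 - int n..a - 1}. int (Suc d) \<le> excess (\<eta>(a - 1 := b)) y a)"
    proof -
      have "{a - int (Suc n)..a} = insert a {a - 1 - int n..a - 1}" by auto
      then show ?thesis by (simp add: excess_empty)
    qed
    also have "\<dots> \<longleftrightarrow> ?R"
    proof (rule bex_cong[OF refl])
      fix y assume "y \<in> {a - 1 - int n..a - 1}"
      then have "excess (\<eta>(a - 1 := b)) y a = excess \<eta> y (a - 1) + (if b then 1 else -1)"
        using excess_cong[of y "a - 1" "\<eta>(a - 1 := b)" \<eta>] by (subst excess_right) auto
      then show "int (Suc d) \<le> excess (\<eta>(a - 1 := b)) y a
          \<longleftrightarrow> int (Suc d) - (if b then 1 else -1) \<le> excess \<eta> y (a - 1)"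
        by auto
    qed
    finally show ?thesis .
  qed
  have "measure (bernoulli_product \<rho>) {\<eta>. \<exists>y\<in>{a - int (Suc n)..a}. int (Suc d) \<le> excess \<eta> y a}
      = \<rho> * measure (bernoulli_product \<rho>) {\<eta>. \<exists>y\<in>{a - 1 - int n..a - 1}. int (Suc d) - 1 \<le> excess \<eta> y (a - 1)}
      + (1 - \<rho>) * measure (bernoulli_product \<rho>)
          {\<eta>. \<exists>y\<in>{a - 1 - int n..a - 1}. int (Suc d) + 1 \<le> excess \<eta> y (a - 1)}"
    using resample_site[where i = "a - 1" and E = "\<lambda>\<eta>. \<exists>y\<in>{a - int (Suc n)..a}. int (Suc d) \<le> excess \<eta> y a"]
      "3.prems" unfolding * by simp
  moreover have "int (Suc d) - 1 = int d" and "int (Suc d) + 1 = int (Suc (Suc d))"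
    by simp_all
  ultimately show ?case
    using 3 by (simp only: hit_prob.simps)
qed

context
  fixes \<rho> :: real
  assumes \<rho>: "0 < \<rho>" "\<rho> < 1 / 2"
begin

text \<open>With \<open>r = \<rho> / (1 - \<rho>)\<close>, the powers of \<open>r\<close> are a
  fixed point of the recursion, as \<open>\<rho> + (1 - \<rho>) * (r * r) = r\<close>, and they
  dominate the values at \<open>n = 0\<close>.\<close>

lemma hit_prob_le: "hit_prob \<rho> n d \<le> (\<rho> / (1 - \<rho>)) ^ d"
proof (induction n arbitrary: d)
  case 0
  then show ?case using \<rho> by (cases d) auto
next
  case (Suc n)
  show ?case
  proof (cases d)
    case (Suc e)
    let ?r = "\<rho> / (1 - \<rho>)"
    have "\<rho> * hit_prob \<rho> n e + (1 - \<rho>) * hit_prob \<rho> n (Suc (Suc e)) \<le> \<rho> * ?r ^ e + (1 - \<rho>) * ?r ^ Suc (Suc e)"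
      using \<rho> by (intro add_mono mult_left_mono Suc.IH) auto
    also have "\<dots> = (\<rho> + (1 - \<rho>) * (?r * ?r)) * ?r ^ e"
      by (simp add: algebra_simps)
    also have "\<rho> + (1 - \<rho>) * (?r * ?r) = ?r"
    proof -
      have "\<rho> + ((1 - \<rho>) * ?r) * ?r = (1 - \<rho>) * ?r + \<rho> * ?r"
        using \<rho> by simp
      then show ?thesis by (simp only: mult.assoc flip: distrib_right) simp
    qed
    finally show ?thesis by (simp add: Suc)
  qed simp
qed

text \<open>The limiting probabilities solve a linear recurrence of order two whose characteristic roots
  are \<open>1\<close> and \<open>\<rho> / (1 - \<rho>)\<close>; the bound above rules out the root \<open>1\<close>.\<close>

lemma prob_max_excess_ge:
  "measure (bernoulli_product \<rho>) {\<eta>. \<exists>y\<le>a. int d \<le> excess \<eta> y a} = (\<rho> / (1 - \<rho>)) ^ d"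
proof -
  interpret prob_space "bernoulli_product \<rho>" by (rule prob_space_bernoulli_product)
  let ?r = "\<rho> / (1 - \<rho>)"
  define Q where "Q d = prob {\<eta>. \<exists>y\<le>a. int d \<le> excess \<eta> y a}" for d
  \<comment> \<open>Continuity from below along windows growing to the left.\<close>
  have lim: "(\<lambda>n. hit_prob \<rho> n d) \<longlonglongrightarrow> Q d" for d
  proof -
    let ?A = "\<lambda>n. {\<eta>. \<exists>y\<in>{a - int n..a}. int d \<le> excess \<eta> y a}"
    have "(\<lambda>n. prob (?A n)) \<longlonglongrightarrow> prob (\<Union>n. ?A n)"
    proof (rule finite_Lim_measure_incseq)
      have "?A n = {\<eta> \<in> space (bernoulli_product \<rho>). \<exists>y\<in>{a - int n..a}. int d \<le> excess \<eta> y a}" for n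
        by simp
      also have "\<dots> n \<in> events" for n by measurable
      finally show "range ?A \<subseteq> events" by blast
      show "incseq ?A" by (force simp: incseq_def)
    qed
    also have "(\<Union>n. ?A n) = {\<eta>. \<exists>y\<le>a. int d \<le> excess \<eta> y a}"
    proof safe
      fix \<eta> y assume "y \<le> a" "int d \<le> excess \<eta> y a"
      then show "\<eta> \<in> (\<Union>n. ?A n)"
        by (intro UN_I[of "nat (a - y)"]) auto
    qed auto
    finally show ?thesis
      using \<rho> by (simp add: prob_excess_hit Q_def)
  qed
  have Q_rec: "Q (Suc d) = \<rho> * Q d + (1 - \<rho>) * Q (Suc (Suc d))" for d
  proof (rule LIMSEQ_unique)
    show "(\<lambda>n. hit_prob \<rho> (Suc n) (Suc d)) \<longlonglongrightarrow> Q (Suc d)"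
      by (rule LIMSEQ_Suc[OF lim])
    show "(\<lambda>n. hit_prob \<rho> (Suc n) (Suc d)) \<longlonglongrightarrow> \<rho> * Q d + (1 - \<rho>) * Q (Suc (Suc d))"
      unfolding hit_prob.simps by (intro tendsto_intros lim)
  qed
  have Q_0: "Q 0 = 1"
    using LIMSEQ_unique[OF lim[of 0]] by simp
  have "Q d \<le> ?r ^ d" for d
    by (rule LIMSEQ_le_const2[OF lim]) (auto intro: hit_prob_le)
  moreover have "(\<lambda>d. ?r ^ d) \<longlonglongrightarrow> 0"
    using \<rho> by (intro LIMSEQ_power_zero) (simp add: field_simps)
  ultimately have Q_lim: "Q \<longlonglongrightarrow> 0"
    by (intro tendsto_sandwich[of "\<lambda>_. 0" Q sequentially "\<lambda>d. ?r ^ d"]) (auto simp: Q_def)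
  \<comment> \<open>Splitting off the root 1: the recurrence says that this combination does not
    depend on \<open>d\<close>. Since \<open>Q\<close> tends to 0, the constant is 0.\<close>
  have const: "Q (Suc d) - ?r * Q d = Q 1 - ?r * Q 0" for d
  proof (induction d)
    case (Suc d)
    have "Q (Suc (Suc d)) - ?r * Q (Suc d) = Q (Suc d) - ?r * Q d"
      using Q_rec[of d] \<rho> by (simp add: field_simps)
    with Suc show ?case by simp
  qed simp
  have "(\<lambda>d. Q (Suc d) - ?r * Q d) \<longlonglongrightarrow> 0 - ?r * 0"
    by (intro tendsto_intros LIMSEQ_Suc Q_lim)
  then have "Q 1 - ?r * Q 0 = 0"
    unfolding const by (simp add: LIMSEQ_const_iff)
  then have "Q (Suc d) = ?r * Q d" for d
    using const[of d] by simp
  then have "Q d = ?r ^ d"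
    by (induction d) (use Q_0 in auto)
  then show ?thesis by (simp add: Q_def)
qed

section \<open>Almost sure existence of holes and of the maximum\<close>

lemma prob_occupied: "measure (bernoulli_product \<rho>) {\<eta>. \<forall>j\<in>{n..<n + int k}. \<eta> j} = \<rho> ^ k"
proof (induction k arbitrary: n)
  case 0
  then show ?case
    using prob_space.prob_space[OF prob_space_bernoulli_product[of \<rho>]] by simp
next
  case (Suc k)
  have split: "{n..<n + int (Suc k)} = insert n {n + 1..<n + 1 + int k}" by auto
  have "measure (bernoulli_product \<rho>) {\<eta>. \<forall>j\<in>{n..<n + int (Suc k)}. \<eta> j}
      = \<rho> * measure (bernoulli_product \<rho>) {\<eta>. \<forall>j\<in>{n + 1..<n + 1 + int k}. \<eta> j}"
    using resample_site[where \<rho> = \<rho> and i = n and E = "\<lambda>\<eta>. \<forall>j\<in>{n..<n + int (Suc k)}. \<eta> j"] \<rho>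
    unfolding split by simp
  then show ?case by (simp add: Suc)
qed

text \<open>A fully occupied half-line contains occupied blocks of every length \<open>k\<close>,
  each of probability \<open>\<rho> ^ k\<close>; there are only countably many
  \<open>n\<close>.\<close>

lemma AE_infinite_holes: "AE \<eta> in bernoulli_product \<rho>. \<forall>n. \<exists>j\<ge>n. \<not> \<eta> j"
  unfolding AE_all_countable
proof
  fix n :: int
  interpret prob_space "bernoulli_product \<rho>" by (rule prob_space_bernoulli_product)
  have "{\<eta> \<in> space (bernoulli_product \<rho>). \<forall>j\<in>{n..}. \<eta> j} \<in> events" by measurable
  then have ev: "{\<eta>. \<forall>j\<ge>n. \<eta> j} \<in> events" by (simp add: Ball_def)
  have "prob {\<eta>. \<forall>j\<ge>n. \<eta> j} \<le> \<rho> ^ k" for k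
  proof -
    have "{\<eta> \<in> space (bernoulli_product \<rho>). \<forall>j\<in>{n..<n + int k}. \<eta> j} \<in> events" by measurable
    then show ?thesis
      unfolding prob_occupied[of n k, symmetric] by (intro finite_measure_mono) auto
  qed
  moreover have "(\<lambda>k. \<rho> ^ k) \<longlonglongrightarrow> 0"
    using \<rho> by (intro LIMSEQ_power_zero) simp
  ultimately have "prob {\<eta>. \<forall>j\<ge>n. \<eta> j} \<le> 0"
    by (intro LIMSEQ_le_const) auto
  then have "prob {\<eta>. \<forall>j\<ge>n. \<eta> j} = 0"
    using measure_nonneg[of _ "{\<eta>. \<forall>j\<ge>n. \<eta> j}"] by (intro antisym) auto
  then have "{\<eta>. \<forall>j\<ge>n. \<eta> j} \<in> null_sets (bernoulli_product \<rho>)"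
    using ev by (simp add: null_sets_def emeasure_eq_measure)
  then show "AE \<eta> in bernoulli_product \<rho>. \<exists>j\<ge>n. \<not> \<eta> j"
    by (rule AE_I') auto
qed

text \<open>A walk without a maximum reaches every level, and the probability of reaching level
  \<open>d\<close> tends to 0.\<close>

lemma AE_max_excess: "AE \<eta> in bernoulli_product \<rho>. \<exists>m. is_max_excess \<eta> x (int m)"
proof -
  interpret prob_space "bernoulli_product \<rho>" by (rule prob_space_bernoulli_product)
  let ?B = "{\<eta>. \<forall>d. \<exists>y\<le>x. int d \<le> excess \<eta> y x}"
  have "{\<eta> \<in> space (bernoulli_product \<rho>). \<forall>d. \<exists>y\<in>{..x}. int d \<le> excess \<eta> y x} \<in> events" by measurable
  then have ev: "?B \<in> events" by (simp add: Bex_def)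
  have "prob ?B \<le> (\<rho> / (1 - \<rho>)) ^ d" for d
  proof -
    have "{\<eta> \<in> space (bernoulli_product \<rho>). \<exists>y\<in>{..x}. int d \<le> excess \<eta> y x} \<in> events" by measurable
    then show ?thesis
      unfolding prob_max_excess_ge[of x d, symmetric] by (intro finite_measure_mono) (auto simp: Bex_def)
  qed
  moreover have "(\<lambda>d. (\<rho> / (1 - \<rho>)) ^ d) \<longlonglongrightarrow> 0"
    using \<rho> by (intro LIMSEQ_power_zero) (simp add: field_simps)
  ultimately have "prob ?B \<le> 0"
    by (intro LIMSEQ_le_const) auto
  then have "prob ?B = 0"
    using measure_nonneg[of _ ?B] by (intro antisym) auto
  then have "?B \<in> null_sets (bernoulli_product \<rho>)"
    using ev by (simp add: null_sets_def emeasure_eq_measure)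
  then show ?thesis
  proof (rule AE_I', safe)
    fix \<eta> d assume none: "\<nexists>m. is_max_excess \<eta> x (int m)"
    let ?P = "\<lambda>d. \<exists>y\<le>x. int d \<le> excess \<eta> y x"
    \<comment> \<open>The values are integers, so reaching \<open>d\<close> but not
      \<open>Suc d\<close> would make \<open>d\<close> the maximum.\<close>
    show "?P d"
    proof (induction d)
      case 0
      then show ?case by (intro exI[of _ x]) (simp add: excess_empty)
    next
      case (Suc d)
      then obtain y where y: "y \<le> x" "int d \<le> excess \<eta> y x" by blast
      show ?case
      proof (rule ccontr)
        assume "\<not> ?P (Suc d)"
        then have le: "excess \<eta> z x \<le> int d" if "z \<le> x" for z
          using that by force
        have "excess \<eta> y x = int d" using le[of y] y by simp
        then have "is_max_excess \<eta> x (int d)"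
          using y le by (auto simp: is_max_excess_def)
        with none show False by blast
      qed
    qed
  qed
qed

end

section \<open>Measurability of the trajectory and of the distance\<close>

lemma measurable_ftasep [measurable]: "Measurable.pred (bernoulli_product \<rho>) (\<lambda>\<eta>. ftasep \<eta> t j)"
proof (induction t arbitrary: j)
  case 0
  then show ?case by (simp add: ftasep_def)
next
  case (Suc t)
  note [measurable] = Suc
  show ?case
    unfolding ftasep_Suc ftasep_step_def ftasep_jumps_def by measurable
qed

lemma measurable_particle_pos [measurable]:
  "(\<lambda>\<eta>. particle_pos \<eta> x t) \<in> measurable (bernoulli_product \<rho>) (count_space UNIV)"
proof (induction t)
  case (Suc t)
  \<comment> \<open>The configuration is read at a random site: freeze the position at
    \<open>i\<close>, then glue over its countably many values.\<close>
  have "(\<lambda>\<eta>. if ftasep_jumps (ftasep \<eta> t) i then i + 1 else i)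
      \<in> measurable (bernoulli_product \<rho>) (count_space UNIV)" for i
    unfolding ftasep_jumps_def by measurable
  from measurable_compose_countable[OF this Suc] show ?case by simp
qed simp

lemma measurable_jump_times [measurable]:
  "Measurable.pred (bernoulli_product \<rho>) (\<lambda>\<eta>. t \<in> jump_times \<eta> x)"
proof -
  have "Measurable.pred (bernoulli_product \<rho>) (\<lambda>\<eta>. ftasep_jumps (ftasep \<eta> t) i)" for i
    unfolding ftasep_jumps_def by measurable
  from measurable_compose_countable[OF this measurable_particle_pos] show ?thesis
    by (simp add: jump_times_def)
qed

text \<open>Finiteness of the set of jump times is expressed as existence of a bound, which involves
  only countable quantifiers.\<close>

lemma measurable_total_distance [measurable]:
  "(\<lambda>\<eta>. total_distance \<eta> x) \<in> measurable (bernoulli_product \<rho>) (count_space UNIV)"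
  unfolding total_distance_def finite_nat_set_iff_bounded Ball_def by measurable

section \<open>Tails of the distance, the geometric law and its mean\<close>

lemma prob_total_distance_ge:
  assumes \<rho>: "0 < \<rho>" "\<rho> < 1 / 2"
  shows "measure (bernoulli_product \<rho>) {\<eta>. enat d \<le> total_distance \<eta> 0 \<and> \<eta> 0} = \<rho> * (\<rho> / (1 - \<rho>)) ^ d"
proof -
  interpret prob_space "bernoulli_product \<rho>" by (rule prob_space_bernoulli_product)
  let ?E = "\<lambda>\<eta>. (\<exists>y\<in>{..0}. int d \<le> excess \<eta> y 0) \<and> \<eta> 0"
  \<comment> \<open>Almost surely the tail event agrees with an event about the walk and the
    origin.\<close>
  have "AE \<eta> in bernoulli_product \<rho>. (enat d \<le> total_distance \<eta> 0 \<and> \<eta> 0) = ?E \<eta>"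
    using AE_infinite_holes[OF \<rho>] AE_max_excess[OF \<rho>, of 0]
  proof eventually_elim
    case (elim \<eta>)
    then obtain m where m: "is_max_excess \<eta> 0 (int m)" by blast
    show ?case
    proof (cases "\<eta> 0")
      case True
      have "total_distance \<eta> 0 = enat m"
        using True elim(1) m by (intro total_distance_eq_max_excess) auto
      moreover have "(\<exists>y\<in>{..0}. int d \<le> excess \<eta> y 0) \<longleftrightarrow> d \<le> m"
        using m unfolding is_max_excess_def by force
      ultimately show ?thesis by simp
    qed simp
  qed
  then have "prob {\<eta> \<in> space (bernoulli_product \<rho>). enat d \<le> total_distance \<eta> 0 \<and> \<eta> 0}
      = prob {\<eta> \<in> space (bernoulli_product \<rho>). ?E \<eta>}"
    by (intro prob_eq_AE) measurable
  also have "\<dots> = \<rho> * prob {\<eta>. \<exists>y\<le>0. int d \<le> excess \<eta> y 0}"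
  proof -
    \<comment> \<open>The walk reads only sites left of the origin, so resampling the origin splits
      off the factor \<open>\<rho>\<close>; the value \<open>False\<close> contributes 0.\<close>
    have "excess (\<eta>(0 := b)) y 0 = excess \<eta> y 0" for \<eta> b y
      by (rule excess_cong) auto
    then show ?thesis
      using resample_site[where \<rho> = \<rho> and i = 0 and E = ?E] \<rho> by (simp add: Bex_def)
  qed
  also have "\<dots> = \<rho> * (\<rho> / (1 - \<rho>)) ^ d"
    by (simp only: prob_max_excess_ge[OF \<rho>])
  finally show ?thesis by simp
qed

theorem theorem3p9:
  fixes \<rho> :: real
  assumes "0 < \<rho>" and "\<rho> < 1 / 2"
  shows "(\<lambda>\<eta>. total_distance \<eta> 0) \<in> measurable (bernoulli_product \<rho>) (count_space UNIV)
    \<and> (\<forall>d :: nat. \<P>(\<eta> in bernoulli_product \<rho>. total_distance \<eta> 0 = enat d \<bar> \<eta> 0)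
          = (1 - 2 * \<rho>) / (1 - \<rho>) * (\<rho> / (1 - \<rho>)) ^ d)
    \<and> (\<integral>\<^sup>+ \<eta>. ennreal_of_enat (total_distance \<eta> 0)
          \<partial>uniform_measure (bernoulli_product \<rho>) {\<eta> \<in> space (bernoulli_product \<rho>). \<eta> 0})
        = ennreal (\<rho> / (1 - 2 * \<rho>))"
proof (intro conjI allI)
  let ?M = "bernoulli_product \<rho>" and ?r = "\<rho> / (1 - \<rho>)"
  interpret prob_space ?M by (rule prob_space_bernoulli_product)
  define G where "G d = {\<eta>. enat d \<le> total_distance \<eta> 0 \<and> \<eta> 0}" for d
  have G: "prob (G d) = \<rho> * ?r ^ d" for d
    unfolding G_def using assms by (rule prob_total_distance_ge)
  have G_ev: "G d \<in> events" for d
  proof -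
    have "{\<eta> \<in> space ?M. enat d \<le> total_distance \<eta> 0 \<and> \<eta> 0} \<in> events" by measurable
    then show ?thesis by (simp add: G_def)
  qed
  have origin: "{\<eta> \<in> space ?M. \<eta> 0} = G 0"
    by (simp add: G_def flip: zero_enat_def)
  show "(\<lambda>\<eta>. total_distance \<eta> 0) \<in> measurable ?M (count_space UNIV)"
    by (rule measurable_total_distance)
  show "\<P>(\<eta> in ?M. total_distance \<eta> 0 = enat d \<bar> \<eta> 0) = (1 - 2 * \<rho>) / (1 - \<rho>) * ?r ^ d" for d
  proof -
    \<comment> \<open>A point mass is the difference of consecutive tails; the value \<infinity>
      lies in both and cancels.\<close>
    have "enat d \<le> e \<and> \<not> enat (Suc d) \<le> e \<longleftrightarrow> e = enat d" for e
      by (cases e) auto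
    then have "{\<eta> \<in> space ?M. total_distance \<eta> 0 = enat d \<and> \<eta> 0} = G d - G (Suc d)"
      by (auto simp: G_def)
    moreover have "G (Suc d) \<subseteq> G d"
      by (auto simp: G_def intro: order_trans[of "enat d" "enat (Suc d)"])
    ultimately have "prob {\<eta> \<in> space ?M. total_distance \<eta> 0 = enat d \<and> \<eta> 0} = \<rho> * ?r ^ d - \<rho> * ?r ^ Suc d"
      by (simp only: finite_measure_Diff[OF G_ev G_ev] G)
    also have "\<dots> = \<rho> * ((1 - ?r) * ?r ^ d)"
      by (simp add: algebra_simps)
    finally show ?thesis
      unfolding cond_prob_def origin G using assms by (simp add: field_simps)
  qed
  \<comment> \<open>The mean comes from the tail-sum formula, which also covers the value
    \<infinity>.\<close>
  let ?U = "uniform_measure ?M {\<eta> \<in> space ?M. \<eta> 0}"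
  have "(\<integral>\<^sup>+ \<eta>. ennreal_of_enat (total_distance \<eta> 0) \<partial>?U)
      = (\<Sum>d. emeasure ?U {\<eta> \<in> space ?U. enat d < total_distance \<eta> 0})"
    by (intro nn_integral_enat_function) simp
  also have "\<dots> = (\<Sum>d. ennreal (?r ^ Suc d))"
  proof (intro suminf_cong)
    fix d
    have "{\<eta> \<in> space ?M. enat d < total_distance \<eta> 0} \<in> events" by measurable
    then have "emeasure ?U {\<eta> \<in> space ?U. enat d < total_distance \<eta> 0}
        = emeasure ?M (G 0 \<inter> {\<eta>. enat d < total_distance \<eta> 0}) / emeasure ?M (G 0)"
      using G_ev[of 0] unfolding origin by simp
    \<comment> \<open>The strict inequality shifts the index by one, so the geometric series starts
      at \<open>?r\<close> and not at 1.\<close>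
    also have "G 0 \<inter> {\<eta>. enat d < total_distance \<eta> 0} = G (Suc d)"
      by (auto simp: G_def Suc_ile_eq simp flip: zero_enat_def)
    also have "emeasure ?M (G (Suc d)) / emeasure ?M (G 0) = ennreal (?r ^ Suc d)"
      using assms by (simp add: emeasure_eq_measure G divide_ennreal)
    finally show "emeasure ?U {\<eta> \<in> space ?U. enat d < total_distance \<eta> 0} = ennreal (?r ^ Suc d)" .
  qed
  also have "\<dots> = ennreal (\<rho> / (1 - 2 * \<rho>))"
  proof (rule suminf_ennreal_eq)
    have "(\<lambda>d. ?r * ?r ^ d) sums (?r * (1 / (1 - ?r)))"
      using assms by (intro sums_mult geometric_sums) (simp add: field_simps)
    also have "?r * (1 / (1 - ?r)) = \<rho> / (1 - 2 * \<rho>)"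
    proof -
      have "1 - ?r = (1 - 2 * \<rho>) / (1 - \<rho>)"
        using assms by (simp add: field_simps)
      then show ?thesis using assms by simp
    qed
    finally show "(\<lambda>d. ?r ^ Suc d) sums (\<rho> / (1 - 2 * \<rho>))" by simp
  qed (use assms in simp)
  finally show "(\<integral>\<^sup>+ \<eta>. ennreal_of_enat (total_distance \<eta> 0) \<partial>?U) = ennreal (\<rho> / (1 - 2 * \<rho>))" .
qed

end
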